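(* If $G$ is a graph with minimum degree $\delta(G) \ge 3$, then $\gamma_t(G) \le \alpha'(G) + \frac{1}{2}(\mathrm{pc}(G) - 1)$. Moreover, this bound is tight, i.e., there exist graphs $G$ with $\delta(G) \ge 3$ for which equality holds.
   Context: All graphs are finite and simple. A total dominating set of a graph $G$ with no isolated vertex is a set $S \subseteq V(G)$ such that every vertex of $G$ (including those in $S$) is adjacent to at least one vertex of $S$; the total domination number $\gamma_t(G)$ is the minimum cardinality of such a set. The matching number $\alpha'(G)$ is the maximum number of edges in a matching (set of pairwise non-adjacent edges) of $G$. A path cover of $G$ is a collection of vertex-disjoint paths (subgraphs of $G$, single vertices allowed) such that every vertex of $G$ belongs to exactly one of the paths; the path covering number $\mathrm{pc}(G)$ is the minimum cardinality of a path cover of $G$. *)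

theory Defs
  imports Complex_Main
begin

text \<open>
  A graph is given by its vertex set and its set of edges, an edge being a two-element set of
  vertices; so loops and multiple edges are excluded. As usual, the vertex set is nonempty
  (otherwise the minimum degree is undefined).
\<close>

definition simple_graph :: "'a set \<Rightarrow> 'a set set \<Rightarrow> bool" where
  "simple_graph V E \<longleftrightarrow> finite V \<and> V \<noteq> {} \<and> (\<forall>e\<in>E. e \<subseteq> V \<and> card e = 2)"

definition adjacent :: "'a set set \<Rightarrow> 'a \<Rightarrow> 'a \<Rightarrow> bool" where
  "adjacent E u v \<longleftrightarrow> {u, v} \<in> E"

definition degree :: "'a set \<Rightarrow> 'a set set \<Rightarrow> 'a \<Rightarrow> nat" where
  "degree V E v = card {u \<in> V. adjacent E v u}"

definition min_degree :: "'a set \<Rightarrow> 'a set set \<Rightarrow> nat" where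
  "min_degree V E = Min (degree V E ` V)"

definition total_dominating_set :: "'a set \<Rightarrow> 'a set set \<Rightarrow> 'a set \<Rightarrow> bool" where
  "total_dominating_set V E S \<longleftrightarrow> S \<subseteq> V \<and> (\<forall>v\<in>V. \<exists>u\<in>S. adjacent E v u)"

text \<open>Meaningful only for graphs without isolated vertices; otherwise there is no such set.\<close>

definition total_domination_number :: "'a set \<Rightarrow> 'a set set \<Rightarrow> nat" where
  "total_domination_number V E = Min {card S |S. total_dominating_set V E S}"

definition matching :: "'a set set \<Rightarrow> 'a set set \<Rightarrow> bool" where
  "matching E M \<longleftrightarrow> M \<subseteq> E \<and> (\<forall>e\<in>M. \<forall>f\<in>M. e \<noteq> f \<longrightarrow> e \<inter> f = {})"

definition matching_number :: "'a set set \<Rightarrow> nat" where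
  "matching_number E = Max {card M |M. matching E M}"

text \<open>
  A path is given by the list of its vertices in order. A list and its reverse are the same path,
  but this is harmless for counting: the members of a path cover have pairwise disjoint nonempty
  vertex sets, so a cover never contains two lists for the same path.
\<close>

definition path_in :: "'a set \<Rightarrow> 'a set set \<Rightarrow> 'a list \<Rightarrow> bool" where
  "path_in V E p \<longleftrightarrow> p \<noteq> [] \<and> distinct p \<and> set p \<subseteq> V \<and> successively (adjacent E) p"

definition path_cover :: "'a set \<Rightarrow> 'a set set \<Rightarrow> 'a list set \<Rightarrow> bool" where
  "path_cover V E P \<longleftrightarrow> (\<forall>p\<in>P. path_in V E p) \<and> (\<forall>v\<in>V. \<exists>!p. p \<in> P \<and> v \<in> set p)"

definition path_covering_number :: "'a set \<Rightarrow> 'a set set \<Rightarrow> nat" where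
  "path_covering_number V E = Min {card P |P. path_cover V E P}"

end

theory Submission
  imports Defs
begin

text \<open>
  Write $n$ for the number of vertices, $\gamma$ for the total domination number, $\alpha$ for the
  matching number and $k$ for the path covering number.  Two easy estimates give the bound up to
  an additive $1/2$.

  A total dominating set is a transversal of the open neighbourhoods, which are $n$ sets of size at
  least 3 on $n$ vertices.  By the theorem of Chvatal and McDiarmid (\<open>chvatal_mcdiarmid\<close>), $m$ sets
  of size at least 3 on $n$ points have a transversal of size at most $(n + m) / 4$; hence
  $2\gamma \le n$.  On the other hand, matching consecutive vertices along the paths of a minimum
  cover misses at most one vertex per path, so $n \le 2\alpha + k$.

  If the corollary failed, both estimates would be equalities, and this is contradictory:

  \<^item> The graph is cubic.  Putting a vertex of degree at least 4 into the set hits four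
    neighbourhoods at the price of one vertex, which is better than the ratio $(n + m) / 4$ requires
    (\<open>total_domination_number_less_half_if_degree_ge_4\<close>).

  \<^item> It has a bridge that separates an odd set from the rest.  Since $n = 2\alpha + k$, all paths of
    a minimum cover are odd, and no two of them together span a perfectly matchable set.  Inside a
    path, the vertices that can be left unmatched clump into \<open>blocks\<close>, odd intervals that stay
    perfectly matchable when any one vertex is deleted.  Two blocks joined by an edge would merge
    (same path) or enlarge the matching (different paths), so all edges leaving a maximal block end
    in the set $S$ of vertices outside the blocks.  There are $|S| + k$ maximal blocks, but only
    $3|S|$ edges end in $S$; so some block is left by fewer than 3 edges, and by parity by exactly
    one (\<open>odd_path_barrier\<close>, \<open>path_cover_gives_odd_bridge\<close>).  This replaces an appeal to the
    Tutte-Berge formula.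

  \<^item> Such a bridge $uw$ contradicts $2\gamma = n$.  Taking both $u$ and $w$ leaves two independent
    transversal problems, one on each side, and the Chvatal-McDiarmid bound on the odd side is not
    an integer, so rounding gains what is needed
    (\<open>total_domination_number_less_half_if_odd_bridge\<close>).

  Equality holds for the complete graph on four vertices.
\<close>

section \<open>Transversals of set systems with sets of size at least three\<close>

text \<open>
  This is the extremal configuration left over by the reductions in the induction below.
  Viewing the sets as nodes and the points as edges joining the two sets that contain them gives a
  simple cubic graph, in which a matching of size \<open>\<mu>\<close> yields a transversal with
  \<open>card I - \<mu>\<close> points.  So a matching covering three quarters of the nodes is needed; a maximum
  matching does that, because each of its edges can be adjacent to the uncovered nodes at most twice
  unless an augmenting path of length three exists.
\<close>
lemma transversal_linear_2_regular:
  fixes N :: "'i \<Rightarrow> 'v set"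
  assumes fin: "finite V" "finite I"
    and sub: "\<And>i. i \<in> I \<Longrightarrow> N i \<subseteq> V"
    and three: "\<And>i. i \<in> I \<Longrightarrow> card (N i) = 3"
    and deg: "\<And>v. v \<in> V \<Longrightarrow> card {i \<in> I. v \<in> N i} = 2"
    and linear: "\<And>i j x y. \<lbrakk>i \<in> I; j \<in> I; i \<noteq> j; x \<in> N i; x \<in> N j; y \<in> N i; y \<in> N j\<rbrakk> \<Longrightarrow> x = y"
  shows "\<exists>T \<subseteq> V. (\<forall>i \<in> I. N i \<inter> T \<noteq> {}) \<and> 4 * card T \<le> card V + card I"
proof -
  have finN: "finite (N i)" if "i \<in> I" for i
    using sub[OF that] fin finite_subset by blast
  \<comment> \<open>A matching of the dual graph: no set contains two points of \<open>M\<close>.\<close>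
  define indep where "indep M \<longleftrightarrow> M \<subseteq> V \<and> 
    (\<forall>i\<in>I. \<forall>x\<in>M. \<forall>y\<in>M. x \<in> N i \<longrightarrow> y \<in> N i \<longrightarrow> x = y)" for M
  have "indep {}" by (simp add: indep_def)
  moreover have "\<forall>M. indep M \<longrightarrow> card M < Suc (card V)"
    using fin card_mono by (fastforce simp: indep_def less_Suc_eq_le)
  ultimately obtain M where M: "indep M" and Mmax: "\<And>M'. indep M' \<Longrightarrow> card M' \<le> card M"
    using ex_has_greatest_nat[of indep "{}" card "Suc (card V)"] by (metis less_imp_le)
  have MV: "M \<subseteq> V" and finM: "finite M"
    using M fin finite_subset by (auto simp: indep_def)
  have Mind: "x = y" if "i \<in> I" "x \<in> M" "y \<in> M" "x \<in> N i" "y \<in> N i" for i x y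
    using M that by (auto simp: indep_def)
  define star where "star v = {i \<in> I. v \<in> N i}" for v
  \<comment> \<open>\<open>U\<close> consists of the uncovered nodes of the dual graph, \<open>W\<close> of the edges incident with them.\<close>
  define U where "U = {i \<in> I. N i \<inter> M = {}}"
  define W where "W = (\<Union>i\<in>U. N i)"
  have finU: "finite U" and UI: "U \<subseteq> I"
    using fin by (auto simp: U_def)
  have star2: "card (star v) = 2" if "v \<in> V" for v
    using deg[OF that] by (simp add: star_def)
  have finstar: "finite (star v)" for v
    using fin by (simp add: star_def)
  have split_I: "card I = 2 * card M + card U"
  proof -
    have "I = (\<Union>x\<in>M. star x) \<union> U" by (auto simp: star_def U_def)
    moreover have "(\<Union>x\<in>M. star x) \<inter> U = {}" by (auto simp: star_def U_def)
    moreover have "card (\<Union>x\<in>M. star x) = (\<Sum>x\<in>M. card (star x))"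
      using finM finstar Mind by (intro card_UN_disjoint) (auto simp: star_def)
    moreover have "(\<Sum>x\<in>M. card (star x)) = 2 * card M"
      using star2 MV by (simp add: subset_iff)
    ultimately show ?thesis
      by (metis card_Un_disjoint fin(2) finite_Un)
  qed
  have incidences: "3 * card I = 2 * card V"
  proof -
    have "(\<Sum>i\<in>I. card (N i)) = (\<Sum>i\<in>I. \<Sum>v\<in>V. if v \<in> N i then 1 else 0)"
      using sub fin by (intro sum.cong) (auto simp: sum.If_cases Int_absorb1 Collect_conj_eq)
    also have "\<dots> = (\<Sum>v\<in>V. \<Sum>i\<in>I. if v \<in> N i then 1 else 0)"
      by (rule sum.swap)
    also have "\<dots> = (\<Sum>v\<in>V. card (star v))"
      using fin by (intro sum.cong) (auto simp: sum.If_cases star_def Collect_conj_eq)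
    finally show ?thesis using three star2 by simp
  qed
  have U_disjoint: "N i \<inter> N j = {}" if ij: "i \<in> U" "j \<in> U" "i \<noteq> j" for i j
  proof (rule ccontr)
    assume "N i \<inter> N j \<noteq> {}"
    then obtain v where v: "v \<in> N i" "v \<in> N j" by blast
    with ij UI sub have vV: "v \<in> V" by blast
    have "{i, j} \<subseteq> star v" using v ij UI by (auto simp: star_def)
    hence sv: "star v = {i, j}"
      using star2[OF vV] ij finstar by (metis card_2_iff card_subset_eq)
    have "indep (insert v M)"
      unfolding indep_def
    proof (intro conjI ballI impI)
      show "insert v M \<subseteq> V" using vV MV by simp
    next
      fix k x y assume a: "k \<in> I" "x \<in> insert v M" "y \<in> insert v M" "x \<in> N k" "y \<in> N k"
      have "N k \<inter> M = {}" if "v \<in> N k"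
        using that sv a(1) ij by (auto simp: star_def U_def)
      thus "x = y" using a Mind by auto
    qed
    moreover have "v \<notin> M" using v ij by (auto simp: U_def)
    ultimately show False using Mmax[of "insert v M"] finM by simp
  qed
  have cardW: "card W = 3 * card U"
  proof -
    have "card W = (\<Sum>i\<in>U. card (N i))"
      unfolding W_def using finU finN UI U_disjoint by (intro card_UN_disjoint) auto
    thus ?thesis using three UI by (simp add: subset_iff)
  qed
  \<comment> \<open>Every edge in \<open>W\<close> joins an uncovered node to an end of some matching edge \<open>x\<close>; it is charged to \<open>x\<close>.\<close>
  define fibre where "fibre x = W \<inter> (\<Union>i\<in>star x. N i)" for x
  have W_fibre: "W \<subseteq> (\<Union>x\<in>M. fibre x)"
  proof
    fix w assume w: "w \<in> W"
    then obtain i where i: "i \<in> U" "w \<in> N i" by (auto simp: W_def)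
    with UI sub have wV: "w \<in> V" by blast
    have "i \<in> star w" using i UI by (auto simp: star_def)
    then obtain j where j: "j \<in> star w" "j \<noteq> i"
      using star2[OF wV] by (metis card_2_iff insert_iff)
    hence "j \<notin> U" using U_disjoint[of i j] i by (auto simp: star_def)
    then obtain x where "x \<in> M" "x \<in> N j" using j by (auto simp: star_def U_def)
    thus "w \<in> (\<Union>x\<in>M. fibre x)" using w j by (auto simp: fibre_def star_def)
  qed
  have fibre2: "card (fibre x) \<le> 2" if xM: "x \<in> M" for x
  proof -
    obtain e f where ef: "star x = {e, f}" "e \<noteq> f"
      using star2 xM MV by (meson card_2_iff subsetD)
    have eI: "e \<in> I" "f \<in> I" "x \<in> N e" "x \<in> N f" using ef by (auto simp: star_def)
    have xW: "x \<notin> W" using xM by (auto simp: W_def U_def)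
    define A where "A = W \<inter> N e"
    define C where "C = W \<inter> N f"
    have fAC: "fibre x = A \<union> C" by (auto simp: fibre_def A_def C_def ef)
    have "A \<subseteq> N e - {x}" "C \<subseteq> N f - {x}" using xW by (auto simp: A_def C_def)
    hence A2: "card A \<le> 2" and C2: "card C \<le> 2"
      using card_mono[of "N e - {x}" A] card_mono[of "N f - {x}" C] finN three eI by auto
    \<comment> \<open>Edges in \<open>W\<close> at different ends of \<open>x\<close> lead to the same uncovered node: otherwise replacing
      \<open>x\<close> by the two of them is an augmentation.\<close>
    have same: "i = j" if a: "a \<in> A" "a \<in> N i" "i \<in> U" and c: "c \<in> C" "c \<in> N j" "j \<in> U" for a c i j
    proof (rule ccontr)
      assume ij: "i \<noteq> j"
      have nU: "e \<notin> U" "f \<notin> U" using eI xM by (auto simp: U_def)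
      have aV: "a \<in> V" "c \<in> V" using a c UI sub by blast+
      have "{e, i} \<subseteq> star a" "{f, j} \<subseteq> star c" using a c UI eI by (auto simp: star_def A_def C_def)
      hence sa: "star a = {e, i}" "star c = {f, j}"
        using star2[OF aV(1)] star2[OF aV(2)] nU a c finstar by (metis card_2_iff card_subset_eq)+
      have ac: "a \<noteq> c" using sa ij ef nU a c by auto
      have ac': "a \<notin> M" "c \<notin> M" using a c by (auto simp: A_def C_def W_def U_def)
      have "indep (insert a (insert c (M - {x})))"
        unfolding indep_def
      proof (intro conjI ballI impI)
        show "insert a (insert c (M - {x})) \<subseteq> V" using aV MV by auto
      next
        fix k y z assume k: "k \<in> I" "y \<in> insert a (insert c (M - {x}))"
           "z \<in> insert a (insert c (M - {x}))" "y \<in> N k" "z \<in> N k"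
        have 1: "N k \<inter> M \<subseteq> {x}" if "a \<in> N k \<or> c \<in> N k"
        proof -
          have "k \<in> {e, i, f, j}" using that k(1) sa by (auto simp: star_def)
          thus ?thesis using a(3) c(3) Mind[OF _ _ xM] eI by (auto simp: U_def)
        qed
        have 2: "\<not> (a \<in> N k \<and> c \<in> N k)"
        proof
          assume "a \<in> N k \<and> c \<in> N k"
          hence "k \<in> star a" "k \<in> star c" using k(1) by (auto simp: star_def)
          thus False using sa ij ef nU a c by auto
        qed
        show "y = z" using k 1 2 Mind by blast
      qed
      moreover have "card (insert a (insert c (M - {x}))) = Suc (card M)"
        using ac ac' finM xM card_Suc_Diff1[OF finM xM] by simp
      ultimately show False using Mmax by fastforce
    qed
    have single: "a = a'" if "a \<in> W" "a' \<in> W" "a \<in> N g" "a' \<in> N g" "g \<in> I - U"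
      "\<And>i i'. \<lbrakk>i \<in> U; i' \<in> U; a \<in> N i; a' \<in> N i'\<rbrakk> \<Longrightarrow> i = i'" for a a' g
    proof -
      from that obtain i where "i \<in> U" "a \<in> N i" "a' \<in> N i" by (auto simp: W_def)
      thus ?thesis using linear[of i g] that UI by blast
    qed
    have efU: "e \<in> I - U" "f \<in> I - U" using eI xM by (auto simp: U_def)
    show ?thesis
    proof (cases "A = {} \<or> C = {}")
      case True
      thus ?thesis using A2 C2 fAC by auto
    next
      case False
      then obtain a c where a: "a \<in> A" and c: "c \<in> C" by blast
      obtain j where j: "j \<in> U" "c \<in> N j" using c by (auto simp: C_def W_def)
      obtain i where i: "i \<in> U" "a \<in> N i" using a by (auto simp: A_def W_def)
      have "A \<subseteq> {a}"
      proof
        fix a' assume a': "a' \<in> A"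
        have "a = a'"
          by (rule single[of a a' e]) (use a a' efU same[OF _ _ _ c j(2) j(1)] in \<open>auto simp: A_def\<close>)
        thus "a' \<in> {a}" by simp
      qed
      moreover have "C \<subseteq> {c}"
      proof
        fix c' assume c': "c' \<in> C"
        have "c = c'"
        proof (rule single[of c c' f])
          fix k k' assume "k \<in> U" "k' \<in> U" "c \<in> N k" "c' \<in> N k'"
          thus "k = k'" using same[OF a i(2) i(1) c] same[OF a i(2) i(1) c'] by metis
        qed (use c c' efU in \<open>auto simp: C_def\<close>)
        thus "c' \<in> {c}" by simp
      qed
      ultimately have "fibre x \<subseteq> {a, c}" using fAC by auto
      thus ?thesis using card_mono[of "{a,c}" "fibre x"] card_insert_le_m1[of 2 "{c}" a] by auto
    qed
  qed
  have "card W \<le> card (\<Union>x\<in>M. fibre x)"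
    by (rule card_mono[OF _ W_fibre]) (use finM finU finN UI in \<open>auto simp: fibre_def W_def\<close>)
  also have "\<dots> \<le> (\<Sum>x\<in>M. card (fibre x))" using finM by (rule card_UN_le)
  also have "\<dots> \<le> (\<Sum>x\<in>M. 2)" using fibre2 by (rule sum_mono)
  finally have UM: "3 * card U \<le> 2 * card M" using cardW by simp
  define T where "T = M \<union> (\<lambda>i. SOME v. v \<in> N i) ` U"
  have pick: "(SOME v. v \<in> N i) \<in> N i" if "i \<in> I" for i
    using three[OF that] by (metis card.empty ex_in_conv someI_ex zero_neq_numeral)
  have "T \<subseteq> V" using MV pick sub UI by (fastforce simp: T_def)
  moreover have "N i \<inter> T \<noteq> {}" if "i \<in> I" for i
  proof (cases "i \<in> U")
    case True
    thus ?thesis using pick[OF that] by (auto simp: T_def)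
  next
    case False
    thus ?thesis using that by (auto simp: T_def U_def)
  qed
  moreover have "card T \<le> card M + card U"
    unfolding T_def by (meson card_Un_le card_image_le finU add_left_mono order_trans)
  ultimately show ?thesis using UM split_I incidences by (intro exI[of _ T]) auto
qed

text \<open>
  The induction adds a point to the transversal whenever this removes at least four objects, counting
  the sets that are hit and the points that are then contained in no set.  Once
  points contained in no set are discarded, this is possible unless every point lies in exactly two sets and two sets share at most one point.
\<close>
lemma chvatal_mcdiarmid_uniform:
  fixes N :: "'i \<Rightarrow> 'v set"
  assumes "finite V" "finite I"
    and "\<And>i. i \<in> I \<Longrightarrow> N i \<subseteq> V"
    and "\<And>i. i \<in> I \<Longrightarrow> card (N i) = 3"
  shows "\<exists>T \<subseteq> V. (\<forall>i \<in> I. N i \<inter> T \<noteq> {}) \<and> 4 * card T \<le> card V + card I"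
  using assms
proof (induction "card V + card I" arbitrary: V I rule: less_induct)
  case less
  note fin = less.prems(1,2) and sub = less.prems(3) and three = less.prems(4)
  define star where "star v = {i \<in> I. v \<in> N i}" for v
  have finN: "finite (N i)" if "i \<in> I" for i
    using sub[OF that] fin finite_subset by blast
  have star_sub: "star v \<subseteq> I" "finite (star v)" for v using fin by (auto simp: star_def)
  have reduce: ?case
    if x: "x \<in> D" and D: "D \<subseteq> V" and four: "4 \<le> card D + card (star x)"
      and cut: "\<And>i v. i \<in> I \<Longrightarrow> i \<notin> star x \<Longrightarrow> v \<in> D \<Longrightarrow> v \<notin> N i" for x D
  proof -
    have finD: "finite D" using D fin finite_subset by blast
    have cD: "card (V - D) + card D = card V" 
      using card_Diff_subset[OF finD D] card_mono[OF fin(1) D] by simp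
    have cI: "card (I - star x) + card (star x) = card I" 
      using card_Diff_subset[of "star x" I] card_mono[OF fin(2), of "star x"] star_sub by simp
    have "\<exists>T\<subseteq>V - D. (\<forall>i\<in>I - star x. N i \<inter> T \<noteq> {}) \<and> 4 * card T \<le> card (V - D) + card (I - star x)"
      by (rule less.hyps) (use fin sub three four cD cI cut in \<open>auto simp: subset_iff\<close>)
    then obtain T where T: "T \<subseteq> V - D" "\<forall>i\<in>I - star x. N i \<inter> T \<noteq> {}"
      "4 * card T \<le> card (V - D) + card (I - star x)" by blast
    have "card (insert x T) \<le> Suc (card T)" by (rule card_insert_le_m1[of "Suc (card T)", simplified]) simp
    hence "4 * card (insert x T) \<le> card V + card I" using T(3) four cD cI by linarith
    moreover have "insert x T \<subseteq> V" using T(1) x D by auto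
    moreover have "\<forall>i\<in>I. N i \<inter> insert x T \<noteq> {}" using T(2) by (auto simp: star_def)
    ultimately show ?case by blast
  qed
  consider (isolated) v where "v \<in> V" "star v = {}"
    | (big) v where "v \<in> V" "card (star v) \<ge> 3"
    | (one) y where "y \<in> V" "card (star y) = 1" "\<And>v. v \<in> V \<Longrightarrow> card (star v) \<in> {1, 2}"
    | (double) i j x y where "\<And>v. v \<in> V \<Longrightarrow> card (star v) = 2" "i \<in> I" "j \<in> I" "i \<noteq> j" 
        "x \<in> N i" "x \<in> N j" "y \<in> N i" "y \<in> N j" "x \<noteq> y"
    | (linear) "\<And>v. v \<in> V \<Longrightarrow> card (star v) = 2"
        "\<And>i j x y. \<lbrakk>i \<in> I; j \<in> I; i \<noteq> j; x \<in> N i; x \<in> N j; y \<in> N i; y \<in> N j\<rbrakk> \<Longrightarrow> x = y"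
  proof (cases "(\<exists>v\<in>V. star v = {}) \<or> (\<exists>v\<in>V. 3 \<le> card (star v))")
    case True
    thus ?thesis using isolated big by blast
  next
    case False
    have one_or_two: "card (star v) \<in> {1, 2}" if "v \<in> V" for v
    proof -
      have "card (star v) \<noteq> 0" using that False star_sub by auto
      moreover have "\<not> 3 \<le> card (star v)" using that False by auto
      ultimately show ?thesis by auto
    qed
    show ?thesis
    proof (cases "\<exists>y\<in>V. card (star y) = 1")
      case True
      thus ?thesis using one one_or_two by blast
    next
      case False
      hence two: "card (star v) = 2" if "v \<in> V" for v using one_or_two that by blast
      show ?thesis
      proof (cases "\<exists>i\<in>I. \<exists>j\<in>I. i \<noteq> j \<and> (\<exists>x\<in>N i \<inter> N j. \<exists>y\<in>N i \<inter> N j. x \<noteq> y)")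
        case True
        thus ?thesis using double[OF two] by auto
      next
        case False
        show ?thesis by (rule linear[OF two]) (use False in \<open>auto\<close>)
      qed
    qed
  qed
  thus ?case
  proof cases
    case isolated
    have "card (V - {v}) + card I < card V + card I"
      using card_Diff1_less[OF fin(1) isolated(1)] by simp
    hence "\<exists>T\<subseteq>V - {v}. (\<forall>i\<in>I. N i \<inter> T \<noteq> {}) \<and> 4 * card T \<le> card (V - {v}) + card I"
      by (rule less.hyps) (use fin sub three isolated in \<open>auto simp: star_def\<close>)
    thus ?thesis using card_Diff1_le[of V v] by (meson Diff_subset add_le_mono1 order_trans)
  next
    case big
    show ?thesis by (rule reduce[of v "{v}"]) (use big in \<open>auto simp: star_def\<close>)
  next
    case one
    then obtain e where e: "star y = {e}" by (auto simp: card_1_singleton_iff)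
    hence eI: "e \<in> I" "y \<in> N e" by (auto simp: star_def)
    show ?thesis
    proof (cases "\<exists>x\<in>N e. card (star x) = 2")
      case True
      then obtain x where x: "x \<in> N e" "card (star x) = 2" by blast
      have "x \<noteq> y" using x one by auto
      show ?thesis
      proof (rule reduce[of x "{x, y}"])
        fix i v assume i: "i \<in> I" "i \<notin> star x" "v \<in> {x, y}"
        have "i \<notin> star y" using i e x eI by (auto simp: star_def)
        thus "v \<notin> N i" using i by (auto simp: star_def)
      qed (use x one eI sub \<open>x \<noteq> y\<close> in auto)
    next
      case False
      hence all1: "card (star x) = 1" if "x \<in> N e" for x
        using one(3)[of x] that sub[OF eI(1)] by auto
      have star_e: "star x = {e}" if "x \<in> N e" for x
      proof -
        have "e \<in> star x" using that eI by (auto simp: star_def)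
        thus ?thesis using all1[OF that] by (auto simp: card_1_singleton_iff)
      qed
      show ?thesis
      proof (rule reduce[of y "N e"])
        fix i v assume "i \<in> I" "i \<notin> star y" "v \<in> N e"
        thus "v \<notin> N i" using star_e[of v] e by (auto simp: star_def)
      qed (use eI sub three e in auto)
    qed
  next
    case double
    have xV: "x \<in> V" "y \<in> V" using double sub by blast+
    have "star x = {i, j}" "star y = {i, j}" 
      using double(1)[OF xV(1)] double(1)[OF xV(2)] double(2-) star_sub
      by (metis (no_types, lifting) card_2_iff card_subset_eq empty_subsetI insert_subset mem_Collect_eq star_def)+
    thus ?thesis
      by (intro reduce[of x "{x, y}"]) (use double xV in \<open>auto simp: star_def\<close>)
  next
    case linear
    show ?thesis
      by (rule transversal_linear_2_regular[OF fin sub three]) (use linear in \<open>auto simp: star_def\<close>)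
  qed
qed

text \<open>Larger sets can be shrunk to size three, since a transversal of smaller sets is still one.\<close>
lemma chvatal_mcdiarmid:
  fixes N :: "'i \<Rightarrow> 'v set"
  assumes "finite V" "finite I"
    and sub: "\<And>i. i \<in> I \<Longrightarrow> N i \<subseteq> V"
    and three: "\<And>i. i \<in> I \<Longrightarrow> 3 \<le> card (N i)"
  obtains T where "T \<subseteq> V" "\<And>i. i \<in> I \<Longrightarrow> N i \<inter> T \<noteq> {}" "4 * card T \<le> card V + card I"
proof -
  have "\<forall>i\<in>I. \<exists>B. B \<subseteq> N i \<and> card B = 3"
    using obtain_subset_with_card_n[OF three] by metis
  then obtain N' where N': "\<forall>i\<in>I. N' i \<subseteq> N i \<and> card (N' i) = 3"
    by (rule bchoice[THEN exE])
  have "\<exists>T \<subseteq> V. (\<forall>i \<in> I. N' i \<inter> T \<noteq> {}) \<and> 4 * card T \<le> card V + card I"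
    by (rule chvatal_mcdiarmid_uniform[OF assms(1,2)]) (use N' sub in auto)
  then obtain T where T: "T \<subseteq> V" "\<forall>i \<in> I. N' i \<inter> T \<noteq> {}" "4 * card T \<le> card V + card I"
    by auto
  show ?thesis
  proof (rule that[OF T(1) _ T(3)])
    fix i assume "i \<in> I"
    thus "N i \<inter> T \<noteq> {}" using T(2) N' by blast
  qed
qed

section \<open>Total domination and half the number of vertices\<close>
definition neighbours :: "'a set \<Rightarrow> 'a set set \<Rightarrow> 'a \<Rightarrow> 'a set" where
  "neighbours V E v = {u \<in> V. adjacent E v u}"

lemma degree_eq_card_neighbours: "degree V E v = card (neighbours V E v)"
  by (simp add: degree_def neighbours_def)

lemma neighbours_sub: "neighbours V E v \<subseteq> V"
  by (auto simp: neighbours_def)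

lemma adjacent_commute: "adjacent E u v \<longleftrightarrow> adjacent E v u"
  by (simp add: adjacent_def insert_commute)

lemma adjacent_distinct: "simple_graph V E \<Longrightarrow> adjacent E u v \<Longrightarrow> u \<noteq> v"
  by (force simp: simple_graph_def adjacent_def)

lemma simple_graph_finite: "simple_graph V E \<Longrightarrow> finite V"
  by (simp add: simple_graph_def)

lemma min_degree_le_degree: "simple_graph V E \<Longrightarrow> v \<in> V \<Longrightarrow> min_degree V E \<le> degree V E v"
  by (simp add: simple_graph_def min_degree_def)

lemma total_domination_number_le:
  assumes "simple_graph V E" "T \<subseteq> V" "\<And>v. v \<in> V \<Longrightarrow> neighbours V E v \<inter> T \<noteq> {}"
  shows "total_domination_number V E \<le> card T"
  unfolding total_domination_number_def
proof (rule Min_le)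
  have "{card S |S. total_dominating_set V E S} \<subseteq> card ` Pow V"
    by (auto simp: total_dominating_set_def)
  thus "finite {card S |S. total_dominating_set V E S}"
    using simple_graph_finite[OF assms(1)] finite_subset by blast
  have "total_dominating_set V E T"
    using assms(2,3) by (fastforce simp: total_dominating_set_def neighbours_def)
  thus "card T \<in> {card S |S. total_dominating_set V E S}" by blast
qed

lemma total_domination_number_le_half:
  assumes G: "simple_graph V E" and deg: "\<And>v. v \<in> V \<Longrightarrow> 3 \<le> degree V E v"
  shows "2 * total_domination_number V E \<le> card V"
proof -
  have fin: "finite V" by (rule simple_graph_finite[OF G])
  obtain T where T: "T \<subseteq> V" "\<And>v. v \<in> V \<Longrightarrow> neighbours V E v \<inter> T \<noteq> {}" "4 * card T \<le> card V + card V"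
    by (rule chvatal_mcdiarmid[OF fin fin neighbours_sub[of V E]])
      (use deg in \<open>auto simp: degree_eq_card_neighbours\<close>)
  show ?thesis using total_domination_number_le[OF G T(1,2)] T(3) by linarith
qed

text \<open>
  Choosing \<open>v\<close> first hits at least four neighbourhoods, so the remaining problem has at most
  \<open>card V - 1\<close> points and \<open>card V - 4\<close> sets, which gains a quarter over the general bound.
\<close>
lemma total_domination_number_less_half_if_degree_ge_4:
  assumes G: "simple_graph V E" and deg: "\<And>v. v \<in> V \<Longrightarrow> 3 \<le> degree V E v"
    and v: "v \<in> V" "4 \<le> degree V E v"
  shows "2 * total_domination_number V E < card V"
proof -
  have fin: "finite V" by (rule simple_graph_finite[OF G])
  define I where "I = V - neighbours V E v"
  have sub: "neighbours V E x \<subseteq> V - {v}" if "x \<in> I" for x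
    using that v by (auto simp: I_def neighbours_def adjacent_commute)
  obtain T where T: "T \<subseteq> V - {v}" "\<And>x. x \<in> I \<Longrightarrow> neighbours V E x \<inter> T \<noteq> {}"
    "4 * card T \<le> card (V - {v}) + card I"
    by (rule chvatal_mcdiarmid[of "V - {v}" I, OF _ _ sub])
      (use fin deg in \<open>auto simp: degree_eq_card_neighbours I_def\<close>)
  have "card I + degree V E v = card V"
    using fin card_Diff_subset[of "neighbours V E v" V] neighbours_sub[of V E v] card_mono[of V "neighbours V E v"]
    by (simp add: I_def degree_eq_card_neighbours finite_subset)
  moreover have "card (V - {v}) + 1 = card V" using v fin card_Suc_Diff1[of V v] by simp
  moreover have "card (insert v T) \<le> card T + 1" by (simp add: card_insert_le_m1)
  ultimately have "2 * card (insert v T) < card V" using T(3) v(2) by linarith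
  moreover have "total_domination_number V E \<le> card (insert v T)"
  proof (rule total_domination_number_le[OF G])
    fix x assume "x \<in> V"
    thus "neighbours V E x \<inter> insert v T \<noteq> {}"
      using T(2)[of x] v by (cases "x \<in> I") (auto simp: I_def neighbours_def adjacent_commute)
  qed (use T v in auto)
  ultimately show ?thesis by linarith
qed

text \<open>
  One side of a bridge \<open>uw\<close> in a cubic graph, when \<open>u\<close> and \<open>w\<close> are both chosen.  What is still to be
  dominated on the side \<open>X\<close> of \<open>u\<close> are the vertices other than \<open>u\<close> and its two neighbours in \<open>X\<close>,
  and their neighbourhoods lie within \<open>X - {u}\<close>; so there are \<open>card X - 1\<close> points and \<open>card X - 3\<close> sets.
\<close>
lemma dominate_bridge_side:
  assumes G: "simple_graph V E" and cubic: "\<And>v. v \<in> V \<Longrightarrow> degree V E v = 3"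
    and X: "X \<subseteq> V" and uw: "u \<in> X" "w \<in> V - X" "adjacent E u w"
    and bridge: "\<And>a b. a \<in> X \<Longrightarrow> b \<in> V - X \<Longrightarrow> adjacent E a b \<Longrightarrow> a = u \<and> b = w"
  obtains T where "T \<subseteq> X" 
    "\<And>x. x \<in> X \<Longrightarrow> x \<noteq> u \<Longrightarrow> \<not> adjacent E x u \<Longrightarrow> neighbours V E x \<inter> T \<noteq> {}"
    "2 * card T + 2 \<le> card X"
proof -
  have finX: "finite X" by (rule finite_subset[OF X simple_graph_finite[OF G]])
  define D where "D = insert u (neighbours V E u - {w})"
  have "y \<in> X" if "y \<in> neighbours V E u - {w}" for y
    using that bridge[of u y] uw(1) by (auto simp: neighbours_def)
  hence DX: "D \<subseteq> X" using uw by (auto simp: D_def)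
  have "card (neighbours V E u - {w}) = 2" 
    using cubic[of u] uw X by (auto simp: degree_eq_card_neighbours neighbours_def)
  moreover have "u \<notin> neighbours V E u - {w}" 
    using adjacent_distinct[OF G, of u u] by (auto simp: neighbours_def)
  ultimately have cD: "card D = 3" 
    using finite_subset[OF DX finX] by (simp add: D_def)
  have sub: "neighbours V E x \<subseteq> X - {u}" if x: "x \<in> X - D" for x
  proof
    fix y assume "y \<in> neighbours V E x"
    hence y: "y \<in> V" "adjacent E x y" by (auto simp: neighbours_def)
    have "y \<in> X" using bridge[of x y] x y by (auto simp: D_def)
    moreover have "y \<noteq> u"
      using x y uw X by (auto simp: D_def neighbours_def adjacent_commute)
    ultimately show "y \<in> X - {u}" by simp
  qed
  obtain T where T: "T \<subseteq> X - {u}" "\<And>x. x \<in> X - D \<Longrightarrow> neighbours V E x \<inter> T \<noteq> {}"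
    "4 * card T \<le> card (X - {u}) + card (X - D)"
    by (rule chvatal_mcdiarmid[of "X - {u}" "X - D", OF _ _ sub])
      (use finX cubic X in \<open>auto simp: degree_eq_card_neighbours\<close>)
  have "card (X - D) + 3 = card X"
    using card_Diff_subset[OF finite_subset[OF DX finX] DX] card_mono[OF finX DX] cD by simp
  moreover have "card (X - {u}) + 1 = card X" using card_Suc_Diff1[OF finX uw(1)] by simp
  ultimately have "2 * card T + 2 \<le> card X" using T(3) by linarith
  moreover have "neighbours V E x \<inter> T \<noteq> {}" if "x \<in> X" "x \<noteq> u" "\<not> adjacent E x u" for x
    using T(2)[of x] that by (auto simp: D_def neighbours_def adjacent_commute)
  moreover have "T \<subseteq> X" using T(1) by blast
  ultimately show ?thesis using that by metis
qed

text \<open>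
  Both sides together give \<open>2 + (card X - 2) / 2 + (card (V - X) - 2) / 2\<close>, which is half the number of
  vertices.  As \<open>card X\<close> is odd, its summand can be rounded down, and the inequality becomes strict.
\<close>
lemma total_domination_number_less_half_if_odd_bridge:
  assumes G: "simple_graph V E" and cubic: "\<And>v. v \<in> V \<Longrightarrow> degree V E v = 3"
    and X: "X \<subseteq> V" "odd (card X)" and uw: "u \<in> X" "w \<in> V - X" "adjacent E u w"
    and bridge: "\<And>a b. a \<in> X \<Longrightarrow> b \<in> V - X \<Longrightarrow> adjacent E a b \<Longrightarrow> a = u \<and> b = w"
  shows "2 * total_domination_number V E < card V"
proof -
  have fin: "finite V" by (rule simple_graph_finite[OF G])
  obtain S where S: "S \<subseteq> X"
    "\<And>x. x \<in> X \<Longrightarrow> x \<noteq> u \<Longrightarrow> \<not> adjacent E x u \<Longrightarrow> neighbours V E x \<inter> S \<noteq> {}"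
    "2 * card S + 2 \<le> card X"
    by (rule dominate_bridge_side[OF G cubic X(1) uw bridge]) (assumption | rule that)+
  have wu: "w \<in> V - X" "u \<in> V - (V - X)" "adjacent E w u" 
    using uw X by (auto simp: adjacent_commute)
  obtain T where T: "T \<subseteq> V - X"
    "\<And>x. x \<in> V - X \<Longrightarrow> x \<noteq> w \<Longrightarrow> \<not> adjacent E x w \<Longrightarrow> neighbours V E x \<inter> T \<noteq> {}"
    "2 * card T + 2 \<le> card (V - X)"
  proof (rule dominate_bridge_side[OF G cubic Diff_subset wu])
    fix a b assume "a \<in> V - X" "b \<in> V - (V - X)" "adjacent E a b"
    thus "a = w \<and> b = u" using bridge[of b a] by (auto simp: adjacent_commute)
  qed (assumption | rule that)+
  have "2 * card S + 3 \<le> card X" using S(3) X(2) by presburger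
  moreover have "card (V - X) + card X = card V"
    using card_Diff_subset[OF finite_subset[OF X(1) fin] X(1)] card_mono[OF fin X(1)] by simp
  moreover have "card ({u, w} \<union> (S \<union> T)) \<le> 2 + (card S + card T)"
    by (rule order_trans[OF card_Un_le add_mono[OF _ card_Un_le]]) (simp add: card_insert_if)
  ultimately have "2 * card ({u, w} \<union> (S \<union> T)) < card V" using T(3) by linarith
  moreover have "total_domination_number V E \<le> card ({u, w} \<union> (S \<union> T))"
  proof (rule total_domination_number_le[OF G])
    fix x assume x: "x \<in> V"
    have V: "u \<in> V" "w \<in> V" using uw X by auto
    show "neighbours V E x \<inter> ({u, w} \<union> (S \<union> T)) \<noteq> {}"
    proof (cases "adjacent E x u \<or> adjacent E x w")
      case True
      thus ?thesis using V by (auto simp: neighbours_def)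
    next
      case False
      hence "x \<noteq> u" "x \<noteq> w" using uw(3) wu(3) by auto
      thus ?thesis using S(2)[of x] T(2)[of x] False x by blast
    qed
  qed (use S T uw X in auto)
  ultimately show ?thesis by linarith
qed

section \<open>Perfectly matched vertex sets\<close>
definition perfectly_matched :: "'a set set \<Rightarrow> 'a set \<Rightarrow> bool" where
  "perfectly_matched E X \<longleftrightarrow> (\<exists>M. matching E M \<and> \<Union>M = X)"

lemma perfectly_matched_empty: "perfectly_matched E {}"
  unfolding perfectly_matched_def by (intro exI[of _ "{}"]) (simp add: matching_def)

lemma perfectly_matched_edge: "adjacent E a b \<Longrightarrow> perfectly_matched E {a, b}"
  unfolding perfectly_matched_def
  by (intro exI[of _ "{{a, b}}"]) (simp add: matching_def adjacent_def)

lemma perfectly_matched_Un: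
  assumes "perfectly_matched E X" "perfectly_matched E Y" "X \<inter> Y = {}"
  shows "perfectly_matched E (X \<union> Y)"
proof -
  obtain M M' where M: "matching E M" "\<Union>M = X" "matching E M'" "\<Union>M' = Y"
    using assms by (auto simp: perfectly_matched_def)
  have "matching E (M \<union> M')"
    unfolding matching_def
  proof (intro conjI ballI impI)
    fix e f assume ef: "e \<in> M \<union> M'" "f \<in> M \<union> M'" "e \<noteq> f"
    have cross: "e \<inter> f = {}" if "e \<in> M" "f \<in> M'" for e f
      using that M(2,4) assms(3) by blast
    have same: "e \<inter> f = {}" if "e \<in> N" "f \<in> N" "matching E N" for N
      using that ef(3) by (simp add: matching_def)
    show "e \<inter> f = {}"
      using ef(1,2) cross[of e f] cross[of f e] same[OF _ _ M(1)] same[OF _ _ M(3)]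
      by (auto simp: Int_commute)
  qed (use M in \<open>auto simp: matching_def\<close>)
  thus ?thesis using M by (auto simp: perfectly_matched_def)
qed

lemma perfectly_matched_UN:
  assumes "finite I" "\<And>i. i \<in> I \<Longrightarrow> perfectly_matched E (X i)"
    "\<And>i j. i \<in> I \<Longrightarrow> j \<in> I \<Longrightarrow> i \<noteq> j \<Longrightarrow> X i \<inter> X j = {}"
  shows "perfectly_matched E (\<Union>i\<in>I. X i)"
  using assms
proof (induction I rule: finite_induct)
  case empty
  thus ?case by (simp add: perfectly_matched_empty)
next
  case (insert i I)
  have "perfectly_matched E (X i \<union> (\<Union>i\<in>I. X i))"
  proof (rule perfectly_matched_Un)
    show "X i \<inter> (\<Union>i\<in>I. X i) = {}" using insert.prems(2)[of i] insert.hyps by blast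
  qed (use insert in auto)
  thus ?case by simp
qed

lemma finite_edges: "simple_graph V E \<Longrightarrow> finite E"
  by (rule finite_subset[of _ "Pow V"]) (auto simp: simple_graph_def)

lemma card_Union_matching:
  assumes G: "simple_graph V E" and M: "matching E M"
  shows "card (\<Union>M) = 2 * card M"
proof -
  have two: "card e = 2" if "e \<in> M" for e
    using that M G by (auto simp: matching_def simple_graph_def)
  have "finite e" if "e \<in> M" for e
    using two[OF that] by (simp add: card_ge_0_finite)
  hence "card (\<Union>M) = (\<Sum>e\<in>M. card e)"
    by (intro card_Union_disjoint) (use M in \<open>auto simp: matching_def pairwise_def disjnt_def\<close>)
  thus ?thesis using two by simp
qed

lemma finite_matching_cards: "simple_graph V E \<Longrightarrow> finite {card M |M. matching E M}"
  by (rule finite_subset[of _ "card ` Pow E"]) (auto simp: matching_def finite_edges)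

lemma card_perfectly_matched_le:
  assumes G: "simple_graph V E" and "perfectly_matched E X"
  shows "card X \<le> 2 * matching_number E"
proof -
  obtain M where M: "matching E M" "\<Union>M = X" using assms by (auto simp: perfectly_matched_def)
  have "card M \<le> matching_number E"
    unfolding matching_number_def by (rule Max_ge[OF finite_matching_cards[OF G]]) (use M in blast)
  thus ?thesis using card_Union_matching[OF G M(1)] M(2) by simp
qed

lemma matching_number_le_half:
  assumes G: "simple_graph V E"
  shows "2 * matching_number E \<le> card V"
proof -
  have "matching E {}" by (simp add: matching_def)
  hence "matching_number E \<in> {card M |M. matching E M}"
    unfolding matching_number_def by (intro Max_in finite_matching_cards[OF G]) blast
  then obtain M where M: "matching E M" "matching_number E = card M" by blast
  have "\<Union>M \<subseteq> V" using M(1) G by (auto simp: matching_def simple_graph_def)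
  hence "card (\<Union>M) \<le> card V" by (rule card_mono[OF simple_graph_finite[OF G]])
  thus ?thesis using card_Union_matching[OF G M(1)] M(2) by simp
qed

section \<open>Blocks of a path\<close>

text \<open>
  Subsets of a path are described by their positions in the list (counted from 0), since the arguments
  are about parities of positions.
\<close>
definition indices_matched :: "'a set set \<Rightarrow> 'a list \<Rightarrow> nat set \<Rightarrow> bool" where
  "indices_matched E p A \<longleftrightarrow> perfectly_matched E ((!) p ` A)"

lemma indices_matched_Un:
  assumes "distinct p" "indices_matched E p A" "indices_matched E p B"
    "A \<subseteq> {..<length p}" "B \<subseteq> {..<length p}" "A \<inter> B = {}"
  shows "indices_matched E p (A \<union> B)"
proof -
  have "(!) p ` A \<inter> (!) p ` B = {}"
    using assms(1,4-6) nth_eq_iff_index_eq[OF assms(1)] by (fastforce simp: subset_iff disjoint_iff)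
  thus ?thesis using perfectly_matched_Un assms(2,3) by (fastforce simp: indices_matched_def image_Un)
qed

lemma indices_matched_interval:
  assumes "distinct p" "successively (adjacent E) p" "j \<le> length p" "even (j - i)"
  shows "indices_matched E p {i..<j}"
  using assms(3,4)
proof (induction "j - i" arbitrary: j rule: less_induct)
  case less
  show ?case
  proof (cases "i < j")
    case False
    thus ?thesis by (simp add: indices_matched_def perfectly_matched_empty)
  next
    case True
    with less.prems have ij: "i + 2 \<le> j" by presburger
    define k where "k = j - 2"
    hence k: "j = k + 2" "i \<le> k" using ij by auto
    have "indices_matched E p {i..<k}"
      by (rule less.hyps) (use less.prems k in auto)
    moreover have "adjacent E (p ! k) (p ! Suc k)"
      using assms(2) less.prems k by (simp add: successively_conv_nth)
    hence "indices_matched E p {k, Suc k}"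
      using perfectly_matched_edge by (simp add: indices_matched_def)
    ultimately have "indices_matched E p ({i..<k} \<union> {k, Suc k})"
      by (intro indices_matched_Un[OF assms(1)]) (use less.prems k in auto)
    moreover have "{i..<k} \<union> {k, Suc k} = {i..<j}" using k by auto
    ultimately show ?thesis by simp
  qed
qed

text \<open>
  A block is a factor-critical interval of a path: it is perfectly matchable after the deletion of any
  one vertex.  Its ends are required to have even positions, so that in a path with an odd number of
  vertices the pieces before and after it have even length.
\<close>
definition block :: "'a set set \<Rightarrow> 'a list \<Rightarrow> nat \<Rightarrow> nat \<Rightarrow> bool" where
  "block E p l h \<longleftrightarrow> even l \<and> even h \<and> l \<le> h \<and> h < length p \<and>
     (\<forall>v\<in>{l..h}. indices_matched E p ({l..h} - {v}))"

lemma block_singleton: "even i \<Longrightarrow> i < length p \<Longrightarrow> block E p i i"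
  by (auto simp: block_def indices_matched_def perfectly_matched_empty)

text \<open>The pieces of the larger interval on both sides of the block have even length and are matched along the path.\<close>
lemma block_extend:
  assumes p: "distinct p" "successively (adjacent E) p" and b: "block E p l h"
    and v: "v \<in> {l..h}" and l': "l' \<le> l" "even l'" and h': "h \<le> h'" "even h'" "h' < length p"
  shows "indices_matched E p ({l'..h'} - {v})"
proof -
  have "indices_matched E p {l'..<l}" "indices_matched E p {Suc h..<Suc h'}"
    using b l' h' by (auto intro!: indices_matched_interval[OF p] simp: block_def)
  moreover have "indices_matched E p ({l..h} - {v})" using b v by (simp add: block_def)
  ultimately have "indices_matched E p (({l'..<l} \<union> ({l..h} - {v})) \<union> {Suc h..<Suc h'})"
    by (intro indices_matched_Un[OF p(1)]) (use b h' in \<open>auto simp: block_def\<close>)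
  moreover have "({l'..<l} \<union> ({l..h} - {v})) \<union> {Suc h..<Suc h'} = {l'..h'} - {v}"
    using v l' h' by auto
  ultimately show ?thesis by simp
qed

text \<open>Every deleted vertex lies in one of the two blocks, and that block extends to the union.\<close>
lemma block_union_overlapping:
  assumes p: "distinct p" "successively (adjacent E) p" 
    and b: "block E p l h" "block E p l' h'" and le: "l \<le> l'" "l' \<le> h"
  shows "block E p l (max h h')"
  unfolding block_def
proof (intro conjI ballI)
  have m: "even (max h h')" "max h h' < length p" "even l" using b by (auto simp: block_def max_def)
  fix v assume "v \<in> {l..max h h'}"
  hence "v \<in> {l..h} \<or> v \<in> {l'..h'}" using le by auto
  thus "indices_matched E p ({l..max h h'} - {v})"
    using block_extend[OF p b(1), of v l "max h h'"] block_extend[OF p b(2), of v l "max h h'"] m le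
    by auto
qed (use b in \<open>auto simp: block_def max_def\<close>)

text \<open>
  The interval spanned by two adjacent blocks is like an odd cycle with odd blossoms at its ends.  If a
  vertex \<open>v\<close> strictly between the blocks is deleted, the parity of its position decides: at an even
  position, both remaining pieces have even length; at an odd position, the edge \<open>xy\<close> is used, the blocks
  are matched without \<open>x\<close> and \<open>y\<close>, and the two gaps between the blocks and \<open>v\<close> have even length.
\<close>
lemma block_union_adjacent:
  assumes p: "distinct p" "successively (adjacent E) p" 
    and b: "block E p l h" "block E p l' h'" and hl: "h < l'"
    and xy: "x \<in> {l..h}" "y \<in> {l'..h'}" "adjacent E (p ! x) (p ! y)"
  shows "block E p l h'"
  unfolding block_def
proof (intro conjI ballI)
  have B: "even l" "even h" "l \<le> h" "h < length p" "even l'" "even h'" "l' \<le> h'" "h' < length p"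
    using b by (auto simp: block_def)
  fix v assume v: "v \<in> {l..h'}"
  consider "v \<in> {l..h}" | "v \<in> {l'..h'}" | "h < v" "v < l'" "even v" | "h < v" "v < l'" "odd v"
    using v by fastforce
  thus "indices_matched E p ({l..h'} - {v})"
  proof cases
    case 1
    thus ?thesis using block_extend[OF p b(1), of v l h'] B hl by auto
  next
    case 2
    thus ?thesis using block_extend[OF p b(2), of v l h'] B hl by auto
  next
    case 3
    have "indices_matched E p ({l..<v} \<union> {Suc v..<Suc h'})"
      by (intro indices_matched_Un[OF p(1)] indices_matched_interval[OF p]) (use 3 B hl in auto)
    moreover have "{l..<v} \<union> {Suc v..<Suc h'} = {l..h'} - {v}" using 3 B hl by auto
    ultimately show ?thesis by simp
  next
    case 4
    have I: "indices_matched E p {Suc h..<v}" "indices_matched E p {Suc v..<l'}"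
      by (rule indices_matched_interval[OF p]; use 4 B in simp)+
    have J: "indices_matched E p ({l..h} - {x})" "indices_matched E p ({l'..h'} - {y})"
      using b xy by (auto simp: block_def)
    have K: "indices_matched E p {x, y}" 
      using perfectly_matched_edge[OF xy(3)] by (simp add: indices_matched_def)
    have "indices_matched E p (({l..h} - {x}) \<union> ({l'..h'} - {y}) \<union> {x, y})"
      by (intro indices_matched_Un[OF p(1)] J K) (use B hl xy in auto)
    moreover have "({l..h} - {x}) \<union> ({l'..h'} - {y}) \<union> {x, y} = {l..h} \<union> {l'..h'}"
      using xy by blast
    ultimately have U: "indices_matched E p ({l..h} \<union> {l'..h'})" by simp
    have "indices_matched E p (({l..h} \<union> {l'..h'}) \<union> ({Suc h..<v} \<union> {Suc v..<l'}))"
      by (rule indices_matched_Un[OF p(1) U indices_matched_Un[OF p(1) I]]) (use 4 B in auto)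
    moreover have "({l..h} \<union> {l'..h'}) \<union> ({Suc h..<v} \<union> {Suc v..<l'}) = {l..h'} - {v}"
    proof (rule set_eqI)
      fix i show "i \<in> ({l..h} \<union> {l'..h'}) \<union> ({Suc h..<v} \<union> {Suc v..<l'}) \<longleftrightarrow> i \<in> {l..h'} - {v}"
        using 4(1,2) B(3,7) by (simp, linarith)
    qed
    ultimately show ?thesis by simp
  qed
qed (use b hl in \<open>auto simp: block_def\<close>)

definition maximal_block :: "'a set set \<Rightarrow> 'a list \<Rightarrow> nat \<Rightarrow> nat \<Rightarrow> bool" where
  "maximal_block E p l h \<longleftrightarrow> block E p l h \<and> 
     (\<forall>l' h'. block E p l' h' \<longrightarrow> {l..h} \<subseteq> {l'..h'} \<longrightarrow> l' = l \<and> h' = h)"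

text \<open>A block of greatest length among those containing the given one is maximal.\<close>
lemma ex_maximal_block:
  assumes "block E p l h"
  obtains l' h' where "maximal_block E p l' h'" "{l..h} \<subseteq> {l'..h'}"
proof -
  define Q where "Q b \<longleftrightarrow> block E p (fst b) (snd b) \<and> {l..h} \<subseteq> {fst b..snd b}" for b
  have "Q (l, h)" using assms by (simp add: Q_def)
  moreover have "\<forall>b. Q b \<longrightarrow> snd b - fst b < Suc (length p)" by (auto simp: Q_def block_def)
  ultimately have "\<exists>b. Q b \<and> (\<forall>c. Q c \<longrightarrow> snd c - fst c \<le> snd b - fst b)"
    by (rule ex_has_greatest_nat)
  then obtain b where b: "Q b" and max: "\<And>c. Q c \<Longrightarrow> snd c - fst c \<le> snd b - fst b"
    by blast
  have "maximal_block E p (fst b) (snd b)"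
    unfolding maximal_block_def
  proof (intro conjI allI impI)
    fix l' h' assume *: "block E p l' h'" "{fst b..snd b} \<subseteq> {l'..h'}"
    have "fst b \<le> snd b" using b by (simp add: Q_def block_def)
    moreover have "h' - l' \<le> snd b - fst b"
      using max[of "(l', h')"] * b by (auto simp: Q_def)
    ultimately show "l' = fst b" "h' = snd b" using *(2) by (auto)
  qed (use b in \<open>simp add: Q_def\<close>)
  thus ?thesis using that b by (auto simp: Q_def)
qed

lemma maximal_block_overlap:
  assumes p: "distinct p" "successively (adjacent E) p" 
    and b: "maximal_block E p l h" "maximal_block E p l' h'" and ne: "{l..h} \<inter> {l'..h'} \<noteq> {}"
  shows "l = l' \<and> h = h'"
proof -
  have *: "l = l' \<and> h = h'" 
    if "maximal_block E p l h" "maximal_block E p l' h'" "l \<le> l'" "l' \<le> h" for l h l' h'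
  proof -
    have "block E p l (max h h')"
      using block_union_overlapping[OF p, of l h l' h'] that by (simp add: maximal_block_def)
    moreover have "{l..h} \<subseteq> {l..max h h'}" "{l'..h'} \<subseteq> {l..max h h'}" using that(3) by auto
    ultimately show ?thesis using that(1,2) unfolding maximal_block_def by metis
  qed
  show ?thesis using *[OF b] *[OF b(2,1)] ne by fastforce
qed

lemma maximal_block_adjacent:
  assumes p: "distinct p" "successively (adjacent E) p" 
    and b: "maximal_block E p l h" "maximal_block E p l' h'" 
    and xy: "x \<in> {l..h}" "y \<in> {l'..h'}" "adjacent E (p ! x) (p ! y)"
  shows "l = l' \<and> h = h'"
proof -
  have *: "\<not> h < l'"
    if b: "maximal_block E p l h" "maximal_block E p l' h'" 
      and xy: "x \<in> {l..h}" "y \<in> {l'..h'}" "adjacent E (p ! x) (p ! y)" for l h l' h' x y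
  proof
    assume hl: "h < l'"
    have "block E p l h'"
      by (rule block_union_adjacent[OF p _ _ hl xy]) (use b in \<open>auto simp: maximal_block_def\<close>)
    moreover have "{l..h} \<subseteq> {l..h'}" using hl b by (auto simp: maximal_block_def block_def)
    ultimately have "h' = h" using b(1) unfolding maximal_block_def by metis
    thus False using hl b(2) by (auto simp: maximal_block_def block_def)
  qed
  have "{l..h} \<inter> {l'..h'} \<noteq> {}"
  proof -
    have "\<not> h < l'" "\<not> h' < l" using *[OF b xy] *[OF b(2,1) xy(2,1)] xy(3) by (auto simp: adjacent_commute)
    moreover have "l \<le> h" "l' \<le> h'" using b by (auto simp: maximal_block_def block_def)
    ultimately have "max l l' \<in> {l..h} \<inter> {l'..h'}" by auto
    thus ?thesis by blast
  qed
  thus ?thesis by (rule maximal_block_overlap[OF p b])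
qed

text \<open>
  This sum counts even minus odd positions; as it is 1 for each block and for a whole odd path, it
  will compare the number of maximal blocks with the number of positions outside them.
\<close>
lemma alternating_sum_interval:
  "even l \<Longrightarrow> l \<le> h \<Longrightarrow> even h \<Longrightarrow> (\<Sum>i\<in>{l..h}. (-1) ^ i) = (1::int)"
proof (induction "h - l" arbitrary: h rule: less_induct)
  case less
  show ?case
  proof (cases "l = h")
    case True
    thus ?thesis using less.prems by simp
  next
    case False
    with less.prems have "l + 2 \<le> h" by presburger
    define k where "k = h - 2"
    hence k: "h = Suc (Suc k)" "l \<le> k" using \<open>l + 2 \<le> h\<close> by auto
    have "(\<Sum>i\<in>{l..k}. (-1) ^ i) = (1::int)" by (rule less.hyps) (use less.prems k in auto)
    thus ?thesis using k by simp
  qed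
qed

text \<open>
  The set \<open>S\<close> acts as a barrier in the sense of Tutte: within the path, the odd sets in \<open>F\<close> are
  connected only through \<open>S\<close>, and there is one more of them than \<open>S\<close> has vertices.  The last
  conjunct allows any vertex of these sets to be left free for an edge to another path.
\<close>
definition path_barrier :: "'a set set \<Rightarrow> 'a list \<Rightarrow> 'a set set \<Rightarrow> 'a set \<Rightarrow> bool" where
  "path_barrier E p F S \<longleftrightarrow> set p = \<Union>F \<union> S \<and> finite F \<and> card F = card S + 1 \<and>
     (\<forall>X\<in>F. odd (card X)) \<and> (\<forall>X\<in>F. \<forall>Y\<in>F. X \<noteq> Y \<longrightarrow> X \<inter> Y = {}) \<and>
     (\<forall>X\<in>F. \<forall>Y\<in>F. \<forall>x\<in>X. \<forall>y\<in>Y. adjacent E x y \<longrightarrow> X = Y) \<and>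
     (\<forall>v\<in>\<Union>F. perfectly_matched E (set p - {v}))"

text \<open>
  \<open>F\<close> consists of the maximal blocks and \<open>S\<close> of the vertices outside them.  Each vertex at an even
  position is a block by itself, so \<open>S\<close> has only odd positions, and the alternating sum over all
  positions reads \<open>1 = card F - card S\<close>.
\<close>
lemma odd_path_barrier:
  assumes p: "distinct p" "successively (adjacent E) p" and odd: "odd (length p)"
  obtains F S where "path_barrier E p F S"
proof -
  define L where "L = length p"
  define B where "B = {(l, h). maximal_block E p l h}"
  define C where "C = (\<Union>b\<in>B. {fst b..snd b})"
  define R where "R = {..<L} - C"
  define F where "F = (\<lambda>b. (!) p ` {fst b..snd b}) ` B"
  define S where "S = (!) p ` R"
  have B: "even l" "even h" "l \<le> h" "h < L" if "(l, h) \<in> B" for l h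
    using that by (auto simp: B_def maximal_block_def block_def L_def)
  have finB: "finite B"
    by (rule finite_subset[of _ "{..<L} \<times> {..<L}"]) (use B in fastforce, simp)
  have CL: "C \<subseteq> {..<L}" using B by (fastforce simp: C_def)
  have inj: "inj_on ((!) p) {..<L}" using p(1) by (simp add: inj_on_nth L_def)
  have disj: "b = b'" if "b \<in> B" "b' \<in> B" "{fst b..snd b} \<inter> {fst b'..snd b'} \<noteq> {}" for b b'
    using maximal_block_overlap[OF p, of "fst b" "snd b" "fst b'" "snd b'"] that 
    by (auto simp: B_def split: prod.splits)
  have evenC: "i \<in> C" if i: "even i" "i < L" for i
  proof -
    obtain l h where "maximal_block E p l h" "{i..i} \<subseteq> {l..h}"
      using ex_maximal_block[OF block_singleton] i unfolding L_def by metis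
    thus ?thesis by (force simp: C_def B_def)
  qed
  have cardB: "card B = card R + 1"
  proof -
    have "(\<Sum>i\<in>C. (-1) ^ i) = (\<Sum>b\<in>B. \<Sum>i\<in>{fst b..snd b}. (-1::int) ^ i)"
      unfolding C_def
      by (rule sum.UNION_disjoint) (use finB disj in \<open>blast+\<close>)
    also have "\<dots> = (\<Sum>b\<in>B. 1)"
      by (rule sum.cong) (use B alternating_sum_interval in \<open>auto\<close>)
    finally have 1: "(\<Sum>i\<in>C. (-1) ^ i) = int (card B)" by simp
    have "(\<Sum>i\<in>R. (-1::int) ^ i) = (\<Sum>i\<in>R. -1)"
      by (rule sum.cong) (use evenC in \<open>auto simp: R_def uminus_power_if\<close>)
    hence 2: "(\<Sum>i\<in>R. (-1) ^ i) = - int (card R)" by simp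
    obtain m where m: "L = Suc m" "even m" using odd by (cases L) (auto simp: L_def)
    have "(\<Sum>i<L. (-1::int) ^ i) = 1" 
      using alternating_sum_interval[of 0 m] m by (simp add: lessThan_Suc_atMost atMost_atLeast0)
    moreover have "(\<Sum>i<L. (-1::int) ^ i) = (\<Sum>i\<in>R. (-1) ^ i) + (\<Sum>i\<in>C. (-1) ^ i)"
      unfolding R_def by (rule sum.subset_diff[OF CL]) simp
    ultimately show ?thesis using 1 2 by linarith
  qed
  have UF: "\<Union>F = (!) p ` C" by (auto simp: F_def C_def)
  have sub: "{fst b..snd b} \<subseteq> {..<L}" if "b \<in> B" for b
    using B[of "fst b" "snd b"] that by auto
  have Fdisj: "b = b'" if "b \<in> B" "b' \<in> B" "(!) p ` {fst b..snd b} \<inter> (!) p ` {fst b'..snd b'} \<noteq> {}" for b b'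
    using disj[OF that(1,2)] that(3) inj_on_image_Int[OF inj sub[OF that(1)] sub[OF that(2)]] by auto
  have injF: "inj_on (\<lambda>b. (!) p ` {fst b..snd b}) B"
  proof (rule inj_onI)
    fix b b' assume b: "b \<in> B" "b' \<in> B" 
      "(!) p ` {fst b..snd b} = (!) p ` {fst b'..snd b'}"
    thus "b = b'" using Fdisj[OF b(1,2)] B[of "fst b" "snd b"] B[of "fst b'" "snd b'"]
      by auto
  qed
  have Fb: "\<exists>b\<in>B. X = (!) p ` {fst b..snd b}" if "X \<in> F" for X
    using that by (auto simp: F_def)
  show ?thesis
  proof (rule that[of F S], unfold path_barrier_def, intro conjI ballI impI)
    have "set p = (!) p ` {..<L}" by (auto simp: set_conv_nth L_def)
    also have "{..<L} = C \<union> R" using CL by (auto simp: R_def)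
    finally show "set p = \<Union>F \<union> S" by (simp add: UF S_def image_Un)
    show "finite F" using finB by (simp add: F_def)
    have "card S = card R" unfolding S_def
      by (rule card_image) (use inj in \<open>auto simp: R_def inj_on_diff\<close>)
    thus "card F = card S + 1" using card_image[OF injF] cardB by (simp add: F_def)
  next
    fix X assume "X \<in> F"
    then obtain b where b: "b \<in> B" "X = (!) p ` {fst b..snd b}" using Fb by blast
    have "card X = card {fst b..snd b}"
      unfolding b(2) by (rule card_image) (rule inj_on_subset[OF inj sub[OF b(1)]])
    thus "odd (card X)" using B[of "fst b" "snd b"] b(1) by auto
  next
    fix X Y assume "X \<in> F" "Y \<in> F" "X \<noteq> Y"
    thus "X \<inter> Y = {}" using Fb[of X] Fb[of Y] Fdisj by blast
  next
    fix X Y x y assume XY: "X \<in> F" "Y \<in> F" "x \<in> X" "y \<in> Y" "adjacent E x y"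
    then obtain b b' where b: "b \<in> B" "X = (!) p ` {fst b..snd b}" "b' \<in> B" "Y = (!) p ` {fst b'..snd b'}" 
      using Fb by meson
    then obtain i j where ij: "i \<in> {fst b..snd b}" "x = p ! i" "j \<in> {fst b'..snd b'}" "y = p ! j"
      using XY by blast
    have "fst b = fst b' \<and> snd b = snd b'"
      by (rule maximal_block_adjacent[OF p _ _ ij(1,3)]) (use b ij XY in \<open>auto simp: B_def split: prod.splits\<close>)
    thus "X = Y" using b by simp
  next
    fix v assume "v \<in> \<Union>F"
    then obtain i where i: "i \<in> C" "v = p ! i" by (auto simp: UF)
    then obtain l h where lh: "(l, h) \<in> B" "i \<in> {l..h}" by (auto simp: C_def)
    have "indices_matched E p ({0..L - 1} - {i})"
      by (rule block_extend[OF p _ lh(2)]) 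
        (use lh odd B[OF lh(1)] in \<open>auto simp: B_def maximal_block_def L_def\<close>)
    moreover have "{0..L - 1} = {..<L}" using B[OF lh(1)] by auto
    moreover have "(!) p ` ({..<L} - {i}) = set p - {v}"
      using inj_on_image_set_diff[OF inj, of "{..<L}" "{i}"] i CL by (auto simp: set_conv_nth L_def)
    ultimately show "perfectly_matched E (set p - {v})" by (simp add: indices_matched_def)
  qed
qed


section \<open>Path covers and matchings\<close>
lemma path_cover_disjoint:
  assumes "path_cover V E P" "p \<in> P" "q \<in> P" "p \<noteq> q"
  shows "set p \<inter> set q = {}"
  using assms unfolding path_cover_def path_in_def by blast

lemma path_cover_Union:
  "path_cover V E P \<Longrightarrow> (\<Union>p\<in>P. set p) = V"
  unfolding path_cover_def path_in_def by blast

lemma path_cover_path: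
  "path_cover V E P \<Longrightarrow> p \<in> P \<Longrightarrow> distinct p \<and> successively (adjacent E) p"
  by (simp add: path_cover_def path_in_def)

lemma path_cover_sub:
  assumes "simple_graph V E" "path_cover V E P"
  shows "P \<subseteq> {p. set p \<subseteq> V \<and> length p \<le> card V}"
proof
  fix p assume "p \<in> P"
  hence p: "set p \<subseteq> V" "distinct p" using assms(2) by (auto simp: path_cover_def path_in_def)
  thus "p \<in> {p. set p \<subseteq> V \<and> length p \<le> card V}"
    using card_mono[OF simple_graph_finite[OF assms(1)] p(1)] distinct_card[OF p(2)] by simp
qed

lemma finite_path_cover:
  assumes "simple_graph V E" "path_cover V E P"
  shows "finite P"
  using path_cover_sub[OF assms] finite_lists_length_le[OF simple_graph_finite[OF assms(1)]]
  by (rule finite_subset)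

lemma finite_path_cover_cards:
  assumes "simple_graph V E"
  shows "finite {card P |P. path_cover V E P}"
proof (rule finite_subset)
  show "{card P |P. path_cover V E P} \<subseteq> card ` Pow {p. set p \<subseteq> V \<and> length p \<le> card V}"
    using path_cover_sub[OF assms] by blast
qed (simp add: finite_lists_length_le[OF simple_graph_finite[OF assms]])

lemma path_covering_number_le:
  "simple_graph V E \<Longrightarrow> path_cover V E P \<Longrightarrow> path_covering_number V E \<le> card P"
  unfolding path_covering_number_def by (rule Min_le[OF finite_path_cover_cards]) auto

lemma ex_minimum_path_cover:
  assumes "simple_graph V E"
  obtains P where "path_cover V E P" "card P = path_covering_number V E"
proof -
  have "path_cover V E ((\<lambda>v. [v]) ` V)" by (auto simp: path_cover_def path_in_def)
  hence "path_covering_number V E \<in> {card P |P. path_cover V E P}"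
    unfolding path_covering_number_def by (intro Min_in finite_path_cover_cards[OF assms]) blast
  thus ?thesis using that by auto
qed

text \<open>
  Every path is matched along its edges up to at most one vertex.  If some of the paths, those in \<open>Q\<close>,
  together span a perfectly matched set, nothing is lost on them.
\<close>
lemma matching_from_path_cover:
  assumes G: "simple_graph V E" and P: "path_cover V E P"
    and Q: "Q \<subseteq> P" "perfectly_matched E (\<Union>p\<in>Q. set p)"
  shows "card V + card Q \<le> 2 * matching_number E + card P"
proof -
  have finP: "finite P" by (rule finite_path_cover[OF G P])
  \<comment> \<open>The matched part of a path outside \<open>Q\<close>: its first vertex is dropped when its length is odd.\<close>
  define R where "R p = (if p \<in> Q then set p else (!) p ` {length p mod 2..<length p})" for p :: "'a list"
  have Rsub: "R p \<subseteq> set p" for p by (auto simp: R_def)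
  have disj: "R p \<inter> R q = {}" if "p \<in> P" "q \<in> P" "p \<noteq> q" for p q
    using path_cover_disjoint[OF P that] Rsub[of p] Rsub[of q] by blast
  have cardR: "card (set p) + (if p \<in> Q then 1 else 0) \<le> card (R p) + 1" if "p \<in> P" for p
  proof (cases "p \<in> Q")
    case True
    thus ?thesis by (simp add: R_def)
  next
    case False
    have d: "distinct p" using path_cover_path[OF P that] by simp
    have "card (R p) = length p - length p mod 2"
      using False d by (simp add: R_def card_image inj_on_nth)
    moreover have "length p mod 2 \<le> 1" by simp
    ultimately show ?thesis using False distinct_card[OF d] by simp
  qed
  have "perfectly_matched E (\<Union>p\<in>P - Q. R p)"
  proof (rule perfectly_matched_UN)
    fix p assume p: "p \<in> P - Q"
    have "even (length p - length p mod 2)" by simp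
    hence "indices_matched E p {length p mod 2..<length p}"
      using path_cover_path[OF P, of p] p by (intro indices_matched_interval) auto
    thus "perfectly_matched E (R p)" using p by (simp add: R_def indices_matched_def)
  qed (use finP disj in auto)
  moreover have "(\<Union>p\<in>Q. R p) = (\<Union>p\<in>Q. set p)" by (simp add: R_def)
  moreover have "(\<Union>p\<in>Q. R p) \<inter> (\<Union>p\<in>P - Q. R p) = {}"
    using disj Q(1) by blast
  ultimately have "perfectly_matched E ((\<Union>p\<in>Q. R p) \<union> (\<Union>p\<in>P - Q. R p))"
    using Q(2) perfectly_matched_Un by metis
  moreover have "(\<Union>p\<in>Q. R p) \<union> (\<Union>p\<in>P - Q. R p) = (\<Union>p\<in>P. R p)" using Q(1) by blast
  ultimately have "card (\<Union>p\<in>P. R p) \<le> 2 * matching_number E"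
    using card_perfectly_matched_le[OF G] by simp
  moreover have "card (\<Union>p\<in>P. R p) = (\<Sum>p\<in>P. card (R p))"
    by (rule card_UN_disjoint) (use finP disj Rsub finite_subset[OF Rsub] in auto)
  moreover have "card V = (\<Sum>p\<in>P. card (set p))"
    unfolding path_cover_Union[OF P, symmetric]
    by (rule card_UN_disjoint) (use finP path_cover_disjoint[OF P] in auto)
  moreover have "(\<Sum>p\<in>P. card (set p)) + card Q \<le> (\<Sum>p\<in>P. card (R p)) + card P"
  proof -
    have "P \<inter> {p. p \<in> Q} = Q" using Q(1) by blast
    hence "(\<Sum>p\<in>P. if p \<in> Q then 1 else 0) = card Q" using finP by (simp add: sum.If_cases)
    hence "(\<Sum>p\<in>P. card (set p)) + card Q = (\<Sum>p\<in>P. card (set p) + (if p \<in> Q then 1 else 0))"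
      by (simp add: sum.distrib)
    also have "\<dots> \<le> (\<Sum>p\<in>P. card (R p) + 1)" by (rule sum_mono) (rule cardR)
    finally show ?thesis by (simp only: sum.distrib) simp
  qed
  ultimately show ?thesis by linarith
qed

section \<open>Odd bridges in cubic graphs\<close>

text \<open>Each edge inside \<open>X\<close> is counted once in each direction.\<close>
lemma even_card_adjacent_pairs:
  assumes G: "simple_graph V E" and "finite X"
  shows "even (card {(a, b). a \<in> X \<and> b \<in> X \<and> adjacent E a b})"
  using assms(2)
proof (induction X rule: finite_induct)
  case (insert v X)
  define N where "N = {b \<in> X. adjacent E v b}"
  define A where "A = {(a, b). a \<in> X \<and> b \<in> X \<and> adjacent E a b}"
  have "finite A" by (rule finite_subset[of _ "X \<times> X"]) (use insert in \<open>auto simp: A_def\<close>)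
  moreover have "finite N" using insert by (simp add: N_def)
  moreover have "v \<notin> N" using insert by (simp add: N_def)
  moreover have "A \<inter> ({v} \<times> N \<union> N \<times> {v}) = {}" using insert by (auto simp: A_def)
  moreover have "({v} \<times> N) \<inter> (N \<times> {v}) = {}" using \<open>v \<notin> N\<close> by auto
  ultimately have "card (A \<union> ({v} \<times> N \<union> N \<times> {v})) = card A + (card N + card N)"
    by (simp add: card_Un_disjoint card_cartesian_product)
  moreover have "{(a, b). a \<in> insert v X \<and> b \<in> insert v X \<and> adjacent E a b} = A \<union> ({v} \<times> N \<union> N \<times> {v})"
    using adjacent_distinct[OF G, of v v] by (auto simp: A_def N_def adjacent_commute)
  ultimately show ?case using insert.IH by (simp add: A_def)
qed simp

text \<open>
  The edges leaving the members of \<open>F\<close> are distinct edges into \<open>S\<close>, so there are at most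
  \<open>3 * card S\<close> of them, fewer than three per member of \<open>F\<close> on average.  The number of edges leaving an odd
  set of a cubic graph is odd; hence fewer than three means exactly one.
\<close>
lemma odd_bridge_from_barrier:
  assumes G: "simple_graph V E" and cubic: "\<And>v. v \<in> V \<Longrightarrow> degree V E v = 3"
    and F: "finite F" "\<Union>F \<subseteq> V" and S: "S \<subseteq> V" "card S < card F"
    and odd: "\<And>X. X \<in> F \<Longrightarrow> odd (card X)"
    and disj: "\<And>X Y. X \<in> F \<Longrightarrow> Y \<in> F \<Longrightarrow> X \<noteq> Y \<Longrightarrow> X \<inter> Y = {}"
    and leave: "\<And>X x y. \<lbrakk>X \<in> F; x \<in> X; y \<in> V - X; adjacent E x y\<rbrakk> \<Longrightarrow> y \<in> S"
  obtains X u w where "X \<in> F" "u \<in> X" "w \<in> V - X" "adjacent E u w"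
    "\<And>a b. a \<in> X \<Longrightarrow> b \<in> V - X \<Longrightarrow> adjacent E a b \<Longrightarrow> a = u \<and> b = w"
proof -
  have fin: "finite V" by (rule simple_graph_finite[OF G])
  define cut where "cut X = {(a, b). a \<in> X \<and> b \<in> V - X \<and> adjacent E a b}" for X
  have fin_pairs: "finite {(a, b). a \<in> X \<and> b \<in> Y \<and> adjacent E a b}" if "X \<subseteq> V" "Y \<subseteq> V" for X Y
    by (rule finite_subset[of _ "V \<times> V"]) (use that fin in auto)
  have incident: "card {(a, b). a \<in> X \<and> b \<in> V \<and> adjacent E a b} = 3 * card X" if "X \<subseteq> V" for X
  proof -
    have "{(a, b). a \<in> X \<and> b \<in> V \<and> adjacent E a b} = (SIGMA a:X. neighbours V E a)"
      by (auto simp: neighbours_def)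
    moreover have "finite X" by (rule finite_subset[OF that fin])
    moreover have "finite (neighbours V E a)" for a by (rule finite_subset[OF neighbours_sub fin])
    ultimately have "card {(a, b). a \<in> X \<and> b \<in> V \<and> adjacent E a b} = (\<Sum>a\<in>X. card (neighbours V E a))"
      by simp
    also have "\<dots> = (\<Sum>a\<in>X. 3)"
      by (rule sum.cong) (use cubic that in \<open>auto simp: degree_eq_card_neighbours\<close>)
    finally show ?thesis by simp
  qed
  have odd_cut: "odd (card (cut X))" if X: "X \<in> F" for X
  proof -
    have XV: "X \<subseteq> V" using X F by blast
    define A where "A = {(a, b). a \<in> X \<and> b \<in> X \<and> adjacent E a b}"
    have "finite A" "finite (cut X)" using fin_pairs[OF XV, of X] fin_pairs[OF XV, of "V - X"] XV 
      by (auto simp: A_def cut_def)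
    moreover have "A \<inter> cut X = {}" by (auto simp: A_def cut_def)
    moreover have "A \<union> cut X = {(a, b). a \<in> X \<and> b \<in> V \<and> adjacent E a b}"
      using XV by (auto simp: A_def cut_def)
    ultimately have "card A + card (cut X) = 3 * card X"
      using incident[OF XV] card_Un_disjoint by metis
    moreover have "even (card A)"
      unfolding A_def by (rule even_card_adjacent_pairs[OF G finite_subset[OF XV fin]])
    ultimately show ?thesis using odd[OF X] by (metis even_add even_mult_iff odd_numeral)
  qed
  have "\<exists>X\<in>F. card (cut X) < 3"
  proof (rule ccontr)
    assume "\<not> (\<exists>X\<in>F. card (cut X) < 3)"
    hence "(\<Sum>X\<in>F. 3) \<le> (\<Sum>X\<in>F. card (cut X))" by (intro sum_mono) (simp add: not_less)
    also have "\<dots> = card (\<Union>X\<in>F. cut X)"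
    proof (rule card_UN_disjoint[symmetric, OF F(1)])
      show "\<forall>X\<in>F. finite (cut X)"
      proof
        fix X assume "X \<in> F"
        thus "finite (cut X)" unfolding cut_def using F(2) by (intro fin_pairs) auto
      qed
      show "\<forall>X\<in>F. \<forall>Y\<in>F. X \<noteq> Y \<longrightarrow> cut X \<inter> cut Y = {}" using disj by (fastforce simp: cut_def)
    qed
    also have "\<dots> \<le> card (prod.swap ` {(a, b). a \<in> S \<and> b \<in> V \<and> adjacent E a b})"
    proof (rule card_mono)
      show "(\<Union>X\<in>F. cut X) \<subseteq> prod.swap ` {(a, b). a \<in> S \<and> b \<in> V \<and> adjacent E a b}"
      proof
        fix z assume "z \<in> (\<Union>X\<in>F. cut X)"
        then obtain X a b where X: "X \<in> F" "z = (a, b)" "a \<in> X" "b \<in> V - X" "adjacent E a b"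
          by (auto simp: cut_def)
        hence "(b, a) \<in> {(a, b). a \<in> S \<and> b \<in> V \<and> adjacent E a b}"
          using leave[OF X(1,3-5)] F(2) by (auto simp: adjacent_commute)
        thus "z \<in> prod.swap ` {(a, b). a \<in> S \<and> b \<in> V \<and> adjacent E a b}"
          using X(2) by (force simp: image_iff)
      qed
    qed (use fin_pairs[OF S(1), of V] in simp)
    also have "\<dots> \<le> 3 * card S"
      using card_image_le[OF fin_pairs[OF S(1), of V]] incident[OF S(1)] by simp
    finally show False using S(2) by simp
  qed
  then obtain X where X: "X \<in> F" "card (cut X) < 3" by blast
  have "card (cut X) = 1" using odd_cut[OF X(1)] X(2) by presburger
  then obtain e where e: "cut X = {e}" by (auto simp: card_1_singleton_iff)
  obtain u w where uw: "e = (u, w)" by (cases e)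
  show ?thesis
  proof (rule that[OF X(1), of u w])
    fix a b assume "a \<in> X" "b \<in> V - X" "adjacent E a b"
    hence "(a, b) \<in> cut X" by (simp add: cut_def)
    thus "a = u \<and> b = w" using e uw by simp
  next
    have "(u, w) \<in> cut X" using e uw by simp
    thus "u \<in> X" "w \<in> V - X" "adjacent E u w" by (auto simp: cut_def)
  qed
qed

text \<open>
  When the matching along the paths cannot be improved, every path is odd and there is no edge between
  blocks of different paths: the two paths without the ends of such an edge are perfectly matchable.  So the
  barriers of the single paths combine to a barrier of the whole graph, with as many
  sets in excess as there are paths.
\<close>
lemma path_cover_gives_odd_bridge:
  assumes G: "simple_graph V E" and cubic: "\<And>v. v \<in> V \<Longrightarrow> degree V E v = 3"
    and P: "path_cover V E P" and tight: "card V = 2 * matching_number E + card P"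
  obtains X u w where "X \<subseteq> V" "odd (card X)" "u \<in> X" "w \<in> V - X" "adjacent E u w"
    "\<And>a b. a \<in> X \<Longrightarrow> b \<in> V - X \<Longrightarrow> adjacent E a b \<Longrightarrow> a = u \<and> b = w"
proof -
  have finP: "finite P" by (rule finite_path_cover[OF G P])
  have VP: "(\<Union>p\<in>P. set p) = V" by (rule path_cover_Union[OF P])
  have no_gain: "card Q = 0" if "Q \<subseteq> P" "perfectly_matched E (\<Union>p\<in>Q. set p)" for Q
    using matching_from_path_cover[OF G P that] tight by simp
  have "\<forall>p\<in>P. \<exists>FS. path_barrier E p (fst FS) (snd FS)"
  proof
    fix p assume p: "p \<in> P"
    note path = path_cover_path[OF P p, THEN conjunct1] path_cover_path[OF P p, THEN conjunct2]
    have "odd (length p)"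
    proof
      assume "even (length p)"
      hence "perfectly_matched E (set p)"
        using indices_matched_interval[OF path order_refl, of 0] 
        by (simp add: indices_matched_def nth_image)
      thus False using no_gain[of "{p}"] p by simp
    qed
    then obtain F S where "path_barrier E p F S" by (rule odd_path_barrier[OF path])
    thus "\<exists>FS. path_barrier E p (fst FS) (snd FS)" by (intro exI[of _ "(F, S)"]) simp
  qed
  then obtain FS where FS: "\<forall>p\<in>P. path_barrier E p (fst (FS p)) (snd (FS p))"
    by (rule bchoice[THEN exE])
  define Fp where "Fp p = fst (FS p)" for p
  define Sp where "Sp p = snd (FS p)" for p
  have parts: "set p = \<Union>(Fp p) \<union> Sp p" "finite (Fp p)" "card (Fp p) = card (Sp p) + 1"
    and oddX: "\<And>X. X \<in> Fp p \<Longrightarrow> odd (card X)"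
    and disjX: "\<And>X Y. X \<in> Fp p \<Longrightarrow> Y \<in> Fp p \<Longrightarrow> X \<noteq> Y \<Longrightarrow> X \<inter> Y = {}"
    and adjX: "\<And>X Y x y. X \<in> Fp p \<Longrightarrow> Y \<in> Fp p \<Longrightarrow> x \<in> X \<Longrightarrow> y \<in> Y \<Longrightarrow> adjacent E x y \<Longrightarrow> X = Y"
    and missX: "\<And>v. v \<in> \<Union>(Fp p) \<Longrightarrow> perfectly_matched E (set p - {v})" if "p \<in> P" for p
  proof -
    have b: "path_barrier E p (Fp p) (Sp p)" using FS that by (simp add: Fp_def Sp_def)
    show "set p = \<Union>(Fp p) \<union> Sp p" "finite (Fp p)" "card (Fp p) = card (Sp p) + 1"
      using b by (simp_all add: path_barrier_def)
    show "odd (card X)" if "X \<in> Fp p" for X 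
      using b that by (simp add: path_barrier_def)
    show "X \<inter> Y = {}" if "X \<in> Fp p" "Y \<in> Fp p" "X \<noteq> Y" for X Y
      using b that by (simp add: path_barrier_def)
    show "X = Y" if "X \<in> Fp p" "Y \<in> Fp p" "x \<in> X" "y \<in> Y" "adjacent E x y" for X Y x y
      using b that unfolding path_barrier_def by blast
    show "perfectly_matched E (set p - {v})" if "v \<in> \<Union>(Fp p)" for v
      using b that unfolding path_barrier_def by blast
  qed
  have Xp: "X \<subseteq> set p" "X \<noteq> {}" if "p \<in> P" "X \<in> Fp p" for p X
    using parts(1)[OF that(1)] oddX[OF that] that(2) by auto
  define F where "F = (\<Union>p\<in>P. Fp p)"
  define S where "S = (\<Union>p\<in>P. Sp p)"
  have cross: "X \<inter> Y = {}" if "p \<in> P" "q \<in> P" "p \<noteq> q" "X \<in> Fp p" "Y \<in> Fp q" for p q X Y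
    using path_cover_disjoint[OF P that(1-3)] Xp[OF that(1,4)] Xp[OF that(2,5)] by blast
  have no_cross_edge: "\<not> adjacent E x y" 
    if pq: "p \<in> P" "q \<in> P" "p \<noteq> q" and xy: "x \<in> \<Union>(Fp p)" "y \<in> \<Union>(Fp q)" for p q x y
  proof
    assume a: "adjacent E x y"
    have D: "set p \<inter> set q = {}" by (rule path_cover_disjoint[OF P pq])
    have x: "x \<in> set p" and y: "y \<in> set q" using xy parts(1) pq by auto
    have "perfectly_matched E (((set p - {x}) \<union> (set q - {y})) \<union> {x, y})"
      by (intro perfectly_matched_Un missX[OF pq(1) xy(1)] missX[OF pq(2) xy(2)] perfectly_matched_edge[OF a])
        (use D x y in auto)
    moreover have "((set p - {x}) \<union> (set q - {y})) \<union> {x, y} = (\<Union>r\<in>{p, q}. set r)"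
      using x y by auto
    ultimately show False using no_gain[of "{p, q}"] pq by simp
  qed
  have "card F = (\<Sum>p\<in>P. card (Fp p))"
    unfolding F_def
  proof (rule card_UN_disjoint[OF finP])
    show "\<forall>p\<in>P. finite (Fp p)" using parts(2) by blast
    show "\<forall>p\<in>P. \<forall>q\<in>P. p \<noteq> q \<longrightarrow> Fp p \<inter> Fp q = {}"
    proof (intro ballI impI equals0I)
      fix p q X assume "p \<in> P" "q \<in> P" "p \<noteq> q" "X \<in> Fp p \<inter> Fp q"
      thus False using cross[of p q X X] Xp(2)[of p X] by simp
    qed
  qed
  also have "\<dots> = (\<Sum>p\<in>P. card (Sp p) + 1)" by (rule sum.cong) (use parts(3) in auto)
  also have "\<dots> = (\<Sum>p\<in>P. card (Sp p)) + card P" by (simp only: sum.distrib) simp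
  finally have cardF: "card F = (\<Sum>p\<in>P. card (Sp p)) + card P" .
  have "P \<noteq> {}" using VP G by (auto simp: simple_graph_def)
  hence "0 < card P" using finP by (simp add: card_gt_0_iff)
  hence SF: "card S < card F" 
    using cardF card_UN_le[OF finP, of Sp] unfolding S_def by linarith
  have finF: "finite F" using finP parts(2) by (simp add: F_def)
  have FV: "\<Union>F \<subseteq> V" and SV: "S \<subseteq> V" using parts(1) VP by (auto simp: F_def S_def)
  have oddF: "odd (card X)" if "X \<in> F" for X using that oddX by (auto simp: F_def)
  have disjF: "X \<inter> Y = {}" if XY: "X \<in> F" "Y \<in> F" "X \<noteq> Y" for X Y
  proof -
    obtain p q where pq: "p \<in> P" "X \<in> Fp p" "q \<in> P" "Y \<in> Fp q" using XY by (auto simp: F_def)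
    show ?thesis
    proof (cases "p = q")
      case True
      thus ?thesis using disjX[OF pq(1,2)] pq(4) XY(3) by simp
    next
      case False
      thus ?thesis using cross[OF pq(1,3) _ pq(2,4)] by simp
    qed
  qed
  have leaveF: "y \<in> S" if xy: "X \<in> F" "x \<in> X" "y \<in> V - X" "adjacent E x y" for X x y
  proof (rule ccontr)
    assume yS: "y \<notin> S"
    obtain p where p: "p \<in> P" "X \<in> Fp p" using xy(1) by (auto simp: F_def)
    obtain q where q: "q \<in> P" "y \<in> set q" using xy(3) VP by blast
    obtain Y where Y: "Y \<in> Fp q" "y \<in> Y" using q parts(1)[OF q(1)] yS by (auto simp: S_def)
    show False
    proof (cases "p = q")
      case True
      thus False using adjX[OF p(1,2) _ xy(2) Y(2) xy(4)] Y xy(3) by auto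
    next
      case False
      thus False using no_cross_edge[OF p(1) q(1) False, of x y] p Y xy by blast
    qed
  qed
  obtain X u w where X: "X \<in> F" "u \<in> X" "w \<in> V - X" "adjacent E u w"
    "\<And>a b. a \<in> X \<Longrightarrow> b \<in> V - X \<Longrightarrow> adjacent E a b \<Longrightarrow> a = u \<and> b = w"
    by (rule odd_bridge_from_barrier[OF G cubic finF FV SV SF oddF disjF leaveF]) (assumption | rule that)+
  show ?thesis
  proof (rule that[OF _ _ X(2-4)])
    show "X \<subseteq> V" using X(1) FV by blast
    show "odd (card X)" by (rule oddF[OF X(1)])
  qed (rule X(5))
qed

section \<open>The bound and its tightness\<close>

text \<open>
  If the bound fails, then \<open>card V\<close> is squeezed between twice the total domination number and
  the matching bound, and the graph must be cubic with an odd bridge.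
\<close>
theorem total_domination_matching_path_cover_bound:
  assumes G: "simple_graph V E" and deg3: "3 \<le> min_degree V E"
  shows "2 * total_domination_number V E + 1 \<le> 2 * matching_number E + path_covering_number V E"
proof (rule ccontr)
  assume contra: "\<not> ?thesis"
  have deg: "3 \<le> degree V E v" if "v \<in> V" for v
    using min_degree_le_degree[OF G that] deg3 by simp
  obtain P where P: "path_cover V E P" "card P = path_covering_number V E"
    by (rule ex_minimum_path_cover[OF G])
  have "card V \<le> 2 * matching_number E + card P"
    using matching_from_path_cover[OF G P(1), of "{}"] by (simp add: perfectly_matched_empty)
  with contra total_domination_number_le_half[OF G deg] P(2)
  have tight: "card V = 2 * matching_number E + card P" "2 * total_domination_number V E = card V"
    by linarith+
  have cubic: "degree V E v = 3" if "v \<in> V" for v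
    using total_domination_number_less_half_if_degree_ge_4[OF G deg that] deg[OF that] tight(2)
    by fastforce
  obtain X u w where X: "X \<subseteq> V" "odd (card X)" "u \<in> X" "w \<in> V - X" "adjacent E u w"
    "\<And>a b. a \<in> X \<Longrightarrow> b \<in> V - X \<Longrightarrow> adjacent E a b \<Longrightarrow> a = u \<and> b = w"
    by (rule path_cover_gives_odd_bridge[OF G cubic P(1) tight(1)]) (assumption | rule that)+
  have "2 * total_domination_number V E < card V"
    by (rule total_domination_number_less_half_if_odd_bridge[OF G cubic X])
  thus False using tight(2) by simp
qed

text \<open>These one-sided estimates suffice: together with the general bound they force equality.\<close>
lemma K4_attains_bound:
  defines "V \<equiv> {0, 1, 2, 3 :: nat}"
  defines "E \<equiv> {e. e \<subseteq> V \<and> card e = 2}"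
  shows "simple_graph V E" "3 \<le> min_degree V E" "2 \<le> total_domination_number V E"
    "matching_number E \<le> 2" "path_covering_number V E \<le> 1"
proof -
  show G: "simple_graph V E" by (auto simp: simple_graph_def V_def E_def)
  have adj: "adjacent E u v \<longleftrightarrow> u \<in> V \<and> v \<in> V \<and> u \<noteq> v" for u v
    by (auto simp: adjacent_def E_def card_insert_if)
  have fin: "finite V" and card4: "card V = 4" by (auto simp: V_def)
  have "degree V E v = 3" if "v \<in> V" for v
  proof -
    have "{u \<in> V. adjacent E v u} = V - {v}" using that by (auto simp: adj)
    thus ?thesis using that fin card4 by (simp add: degree_def)
  qed
  thus "3 \<le> min_degree V E" using fin by (simp add: min_degree_def V_def)
  have TDS: "2 \<le> card S" if S: "total_dominating_set V E S" for S
  proof -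
    have "finite S" using S fin finite_subset by (auto simp: total_dominating_set_def)
    have "0 \<in> V" by (simp add: V_def)
    then obtain u where u: "u \<in> S" "u \<in> V" using S unfolding total_dominating_set_def by blast
    then obtain w where w: "w \<in> S" "w \<noteq> u" using S unfolding total_dominating_set_def adj by metis
    have "card {u, w} \<le> card S" by (rule card_mono) (use u w \<open>finite S\<close> in auto)
    thus ?thesis using w by simp
  qed
  have "total_dominating_set V E V" by (auto simp: total_dominating_set_def adj V_def)
  moreover have "finite {card S |S. total_dominating_set V E S}"
    by (rule finite_subset[of _ "card ` Pow V"]) (use fin in \<open>auto simp: total_dominating_set_def\<close>)
  ultimately have "total_domination_number V E \<in> {card S |S. total_dominating_set V E S}"
    unfolding total_domination_number_def by (intro Min_in) auto
  thus "2 \<le> total_domination_number V E" using TDS by auto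
  show "matching_number E \<le> 2" using matching_number_le_half[OF G] card4 by simp
  have "path_in V E [0, 1, 2, 3]" by (simp add: path_in_def adj) (simp add: V_def)
  moreover have "\<exists>!p. p \<in> {[0, 1, 2, 3]} \<and> v \<in> set p" if "v \<in> V" for v
    by (rule ex1I[of _ "[0, 1, 2, 3]"]) (use that in \<open>auto simp: V_def\<close>)
  ultimately have "path_cover V E {[0, 1, 2, 3]}" by (simp add: path_cover_def)
  thus "path_covering_number V E \<le> 1" using path_covering_number_le[OF G] by force
qed

theorem corollary8:
  "(\<forall>(V :: 'a set) (E :: 'a set set). simple_graph V E \<and> min_degree V E \<ge> 3 \<longrightarrow>
      real (total_domination_number V E) \<le>
        real (matching_number E) + 1 / 2 * (real (path_covering_number V E) - 1)) \<and>
   (\<exists>(V :: nat set) (E :: nat set set). simple_graph V E \<and> min_degree V E \<ge> 3 \<and>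
      real (total_domination_number V E) =
        real (matching_number E) + 1 / 2 * (real (path_covering_number V E) - 1))"
proof (intro conjI allI impI)
  fix V :: "'a set" and E
  assume "simple_graph V E \<and> 3 \<le> min_degree V E"
  hence "2 * total_domination_number V E + 1 \<le> 2 * matching_number E + path_covering_number V E"
    using total_domination_matching_path_cover_bound by blast
  hence "real (2 * total_domination_number V E + 1) \<le> real (2 * matching_number E + path_covering_number V E)"
    by (simp only: of_nat_le_iff)
  thus "real (total_domination_number V E) \<le>
      real (matching_number E) + 1 / 2 * (real (path_covering_number V E) - 1)"
    by (simp add: field_simps)
next
  define V :: "nat set" where "V = {0, 1, 2, 3}"
  define E where "E = {e. e \<subseteq> V \<and> card e = 2}"
  note K4 = K4_attains_bound[folded V_def, folded E_def]
  have "2 * total_domination_number V E + 1 = 2 * matching_number E + path_covering_number V E"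
    using total_domination_matching_path_cover_bound[OF K4(1,2)] K4(3-5) by linarith
  hence "real (2 * total_domination_number V E + 1) = real (2 * matching_number E + path_covering_number V E)"
    by (simp only: of_nat_eq_iff)
  hence "real (total_domination_number V E) =
      real (matching_number E) + 1 / 2 * (real (path_covering_number V E) - 1)"
    by (simp add: field_simps)
  thus "\<exists>(V :: nat set) E. simple_graph V E \<and> 3 \<le> min_degree V E \<and>
      real (total_domination_number V E) =
        real (matching_number E) + 1 / 2 * (real (path_covering_number V E) - 1)"
    using K4(1,2) by blast
qed

end
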